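(* Fix a real number $0 < \lambda < 1$. Then there is a constant $C_\lambda>0$ depending only on $\lambda$ such that for any positive integer $n$ and any $0 < \epsilon < 1$ there exists a polynomial $p(A) = p_{\lambda, n, \epsilon}(A)$ in the entries of an $n \times n$ complex matrix $A$ with $\deg p \leq C_\lambda(\ln n - \ln \epsilon)$ and $$|\ln \operatorname{per}(I + A) - p(A)| \leq \epsilon$$ for every complex $n \times n$ matrix $A = (a_{ij})$ satisfying $$\sum_{j=1}^n |a_{ij}| < \lambda \quad \text{for } i = 1, \ldots, n.$$
   Context: For an $n\times n$ complex matrix $B=(b_{ij})$, $\operatorname{per} B = \sum_{\sigma \in S_n} \prod_{i=1}^n b_{i\sigma(i)}$, where $S_n$ is the symmetric group on $\{1,\ldots,n\}$; $I$ is the $n\times n$ identity matrix. On the convex set of complex $n\times n$ matrices $A$ with $\sum_{j}|a_{ij}|<1$ for every $i$, the function $\operatorname{per}(I+A)$ does not vanish, and $\ln \operatorname{per}(I+A)$ denotes the continuous branch of the logarithm on this set with $\ln \operatorname{per}(I)=0$.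
   Formalization: The degree bound uses ln(max(n,2)) in place of ln n, which changes only n = 1: there the stated bound −C ln ε fails for ε near 1 (e.g. λ = 0.9, where p would have to be constant but ln(1+a) varies by more than 2); for n ≥ 2 the bound is as stated. *)

theory Defs
  imports
    "Jordan_Normal_Form.Matrix"
    "HOL-Analysis.Function_Topology"
    "HOL-Combinatorics.Permutations"
    "HOL-Library.Poly_Mapping"
begin

definition permanent :: "'a :: comm_semiring_1 mat \<Rightarrow> 'a" where
  "permanent B =
     (\<Sum>\<sigma> | \<sigma> permutes {0..<dim_row B}. \<Prod>i = 0..<dim_row B. B $$ (i, \<sigma> i))"

definition row_dominated :: "nat \<Rightarrow> complex mat set" where
  "row_dominated n =
     {A \<in> carrier_mat n n. \<forall>i<n. (\<Sum>j<n. cmod (A $$ (i, j))) < 1}"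

text \<open>
  The type of matrices carries no topology. A map \<open>L\<close> on \<open>n \<times> n\<close> matrices is continuous for the
  Euclidean topology iff \<open>L \<circ> Matrix.mat n n\<close> is continuous for the product topology on families
  of entries, because \<open>Matrix.mat n n\<close> is the projection to the entries with indices below \<open>n\<close>
  and hence an open quotient map.
\<close>

definition is_ln_per_branch :: "nat \<Rightarrow> (complex mat \<Rightarrow> complex) \<Rightarrow> bool" where
  "is_ln_per_branch n L \<longleftrightarrow>
     continuous_on {a :: nat \<times> nat \<Rightarrow> complex. Matrix.mat n n a \<in> row_dominated n}
       (\<lambda>a. L (Matrix.mat n n a)) \<and>
     (\<forall>A \<in> row_dominated n. exp (L A) = permanent (1\<^sub>m n + A)) \<and>
     L (0\<^sub>m n n) = 0"

text \<open>
  Choice rather than definite description: the branch is unique on \<^term>\<open>row_dominated n\<close>, but its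
  values elsewhere are arbitrary.
\<close>

definition ln_per :: "nat \<Rightarrow> complex mat \<Rightarrow> complex" where
  "ln_per n = (SOME L. is_ln_per_branch n L)"

text \<open>
  Polynomials in variables indexed by pairs \<open>(i, j)\<close> (the matrix entries), as finitely supported
  maps from monomials to coefficients; a monomial is a finitely supported map from variables to
  exponents.
\<close>

type_synonym entry_poly = "((nat \<times> nat) \<Rightarrow>\<^sub>0 nat) \<Rightarrow>\<^sub>0 complex"

definition poly_vars :: "entry_poly \<Rightarrow> (nat \<times> nat) set" where
  "poly_vars p = (\<Union>m \<in> Poly_Mapping.keys p. Poly_Mapping.keys m)"

text \<open>The zero polynomial gets degree \<open>0\<close>.\<close>

definition total_degree :: "entry_poly \<Rightarrow> nat" where
  "total_degree p =
     Max (insert 0 ((\<lambda>m. \<Sum>v \<in> Poly_Mapping.keys m. Poly_Mapping.lookup m v) `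
       Poly_Mapping.keys p))"

definition eval_poly :: "entry_poly \<Rightarrow> complex mat \<Rightarrow> complex" where
  "eval_poly p A =
     (\<Sum>m \<in> Poly_Mapping.keys p. Poly_Mapping.lookup p m *
       (\<Prod>v \<in> Poly_Mapping.keys m. (A $$ v) ^ Poly_Mapping.lookup m v))"

text \<open>
  The theorem bounds the degree by \<open>C * (ln (max n 2) - ln \<epsilon>)\<close>, which is \<open>C * (ln n - ln \<epsilon>)\<close> for
  \<open>n \<ge> 2\<close>. For \<open>n = 1\<close> the bound \<open>- C * ln \<epsilon>\<close> is unattainable: as \<open>\<epsilon>\<close> tends to 1 it drops below 1
  and forces a constant polynomial, whereas \<open>ln (1 + a)\<close> with \<open>\<bar>a\<bar> < lam\<close> is not within 1 of a constant
  once \<open>(1 + lam) / (1 - lam) > exp 2\<close>.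
\<close>

end

theory Submission
  imports
    Defs
    "HOL-Analysis.Complex_Transcendental"
    "HOL-Computational_Algebra.Polynomial_FPS"
    "HOL-Computational_Algebra.Fundamental_Theorem_Algebra"
begin

text \<open>
  The polynomial \<open>g z = per (I + z A)\<close> has degree at most \<open>n\<close> and \<open>g 0 = 1\<close>. Permanents of
  row-dominated perturbations of the identity do not vanish, so all roots of \<open>g\<close> have modulus at
  least \<open>1 / \<lambda>\<close> and \<open>g z\<close> is a product of at most \<open>n\<close> factors \<open>1 - w z\<close> with \<open>\<bar>w\<bar> \<le> \<lambda>\<close>. Hence
  the Taylor coefficient of \<open>ln g\<close> at \<open>z^k\<close> is minus the power sum of the \<open>w^k\<close> divided by \<open>k\<close>.
  It is at most \<open>n \<lambda>^k\<close> in modulus, and by Newton's identities it is a polynomial of degree \<open>k\<close> in the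
  entries of \<open>A\<close>. The Taylor polynomial of \<open>ln g\<close> at \<open>z = 1\<close> of order about \<open>ln (n / \<epsilon>)\<close> is
  the required approximation; the full series, which converges locally uniformly, is
  the branch \<open>ln per (I + A)\<close>.
\<close>

section \<open>Permanents over finite index sets and their non-vanishing near the identity\<close>

text \<open>An arbitrary index set allows an induction that removes one index at a time without
  renumbering rows and columns.\<close>

definition permanent_on :: "'a set \<Rightarrow> ('a \<Rightarrow> 'a \<Rightarrow> 'b :: comm_ring_1) \<Rightarrow> 'b" where
  "permanent_on S B = (\<Sum>\<sigma> | \<sigma> permutes S. \<Prod>i\<in>S. B i (\<sigma> i))"

text \<open>Expansion along row \<open>a\<close>. The minor without row \<open>a\<close> and column
  \<open>b\<close> is indexed by \<open>S\<close> again once column \<open>a\<close> takes the place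
  of column \<open>b\<close>. This matches the decomposition of a permutation of
  \<open>insert a S\<close> as the transposition of \<open>a\<close> and \<open>b\<close> after a
  permutation of \<open>S\<close>.\<close>

lemma permanent_on_insert:
  fixes B :: "'a \<Rightarrow> 'a \<Rightarrow> 'b :: comm_ring_1"
  assumes "finite S" "a \<notin> S"
  shows "permanent_on (insert a S) B =
    (\<Sum>b\<in>insert a S. B a b * permanent_on S (\<lambda>k l. if l = b then B k a else B k l))"
proof -
  have "(\<Prod>i\<in>insert a S. B i ((Transposition.transpose a b \<circ> q) i)) =
      B a b * (\<Prod>i\<in>S. if q i = b then B i a else B i (q i))"
    if "q permutes S" for b q
  proof -
    have "q a = a"
      using that assms(2) by (rule permutes_not_in)
    moreover have "q i \<noteq> a" if "i \<in> S" for i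
      using that \<open>q permutes S\<close> assms(2) by (metis permutes_in_image)
    ultimately show ?thesis
      using assms by (auto simp: Transposition.transpose_def intro!: arg_cong2[where f = "(*)"] prod.cong)
  qed
  then show ?thesis
    unfolding permanent_on_def sum_over_permutations_insert[OF assms]
    by (intro sum.cong refl) (simp add: sum_distrib_left)
qed

text \<open>Every permutation meets column \<open>b\<close> in exactly one row, so each product is
  linear in that column.\<close>

lemma permanent_on_column_diff:
  fixes B :: "'a \<Rightarrow> 'a \<Rightarrow> 'b :: comm_ring_1"
  assumes "finite S" "b \<in> S"
  shows "permanent_on S (\<lambda>k l. if l = b then u k - t * v k else B k l) =
    permanent_on S (\<lambda>k l. if l = b then u k else B k l) -
    t * permanent_on S (\<lambda>k l. if l = b then v k else B k l)"
proof -
  have "(\<Prod>i\<in>S. if q i = b then u i - t * v i else B i (q i)) =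
      (\<Prod>i\<in>S. if q i = b then u i else B i (q i)) -
      t * (\<Prod>i\<in>S. if q i = b then v i else B i (q i))"
    if q: "q permutes S" for q
  proof -
    obtain k where k: "k \<in> S" "q k = b"
      using assms(2) q by (metis imageE permutes_image)
    have "(\<Prod>i\<in>S. if q i = b then w i else B i (q i)) = w k * (\<Prod>i\<in>S - {k}. B i (q i))" for w
    proof -
      have "q i \<noteq> b" if "i \<in> S - {k}" for i
        using that k q by (metis DiffD2 inj_eq permutes_inj singletonI)
      then show ?thesis
        using assms(1) k by (subst prod.remove[of S k]) auto
    qed
    then show ?thesis
      by (simp add: algebra_simps)
  qed
  then show ?thesis
    by (simp add: permanent_on_def sum_subtractf sum_distrib_left)
qed

text \<open>
  If \<open>P\<^sub>b\<close> are the minors of the expansion along row \<open>a\<close>, then \<open>P\<^sub>a - t * P\<^sub>b\<close> with \<open>\<bar>t\<bar> \<le> 1\<close> is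
  the permanent of a row-dominated matrix of smaller size. As it never vanishes, \<open>\<bar>P\<^sub>b\<bar> < \<bar>P\<^sub>a\<bar>\<close>,
  so the term \<open>P\<^sub>a\<close> dominates the expansion.
\<close>

lemma permanent_on_row_dominated_nonzero:
  fixes A :: "'a \<Rightarrow> 'a \<Rightarrow> complex"
  assumes "finite S" "\<And>i. i \<in> S \<Longrightarrow> (\<Sum>j\<in>S. cmod (A i j)) < 1"
  shows "permanent_on S (\<lambda>i j. of_bool (i = j) + A i j) \<noteq> 0"
  using assms
proof (induction S arbitrary: A rule: finite_induct)
  case empty
  then show ?case by (simp add: permanent_on_def)
next
  case (insert a S)
  define B where "B = (\<lambda>i j. of_bool (i = j) + A i j)"
  define P where "P b = permanent_on S (\<lambda>k l. if l = b then B k a else B k l)" for b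
  have P_a: "P a = permanent_on S B"
  proof -
    have "(if l = a then B k a else B k l) = B k l" for k l by simp
    then show ?thesis by (simp add: P_def)
  qed
  have row: "cmod (A i a) + (\<Sum>j\<in>S. cmod (A i j)) < 1" if "i \<in> insert a S" for i
    using insert.prems[OF that] insert.hyps by simp
  have nonzero: "P a - t * P b \<noteq> 0" if b: "b \<in> S" and t: "cmod t \<le> 1" for b t
  proof -
    \<comment> \<open>Column \<open>a\<close> is folded into column \<open>b\<close>. Rows in
      \<open>S\<close> have no diagonal entry in column \<open>a\<close>, so the identity part
      survives, and with \<open>cmod t\<close> at most 1 no row sum exceeds the old sum over
      \<open>insert a S\<close>.\<close>
    define A' where "A' = (\<lambda>k l. if l = b then A k b - t * A k a else A k l)"
    have "(\<Sum>j\<in>S. cmod (A' i j)) < 1" if i: "i \<in> S" for i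
    proof -
      have "cmod (A i b - t * A i a) \<le> cmod (A i b) + cmod (t * A i a)"
        by (rule norm_triangle_ineq4)
      also have "cmod (t * A i a) \<le> cmod (A i a)"
        using t by (simp add: norm_mult mult_left_le_one_le)
      finally have "(\<Sum>j\<in>S. cmod (A' i j)) \<le>
          (cmod (A i b) + cmod (A i a)) + (\<Sum>j\<in>S - {b}. cmod (A i j))"
        using b insert.hyps(1) by (subst sum.remove[of S b]) (auto simp: A'_def)
      also have "\<dots> = cmod (A i a) + (\<Sum>j\<in>S. cmod (A i j))"
        using b insert.hyps(1) by (simp add: sum.remove[of S b])
      finally show ?thesis using row[of i] i by simp
    qed
    then have "permanent_on S (\<lambda>i j. of_bool (i = j) + A' i j) \<noteq> 0"
      by (rule insert.IH)
    moreover have "permanent_on S (\<lambda>i j. of_bool (i = j) + A' i j) =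
        permanent_on S (\<lambda>k l. if l = b then B k b - t * B k a else B k l)"
    proof -
      have "of_bool (i = q i) + A' i (q i) = (if q i = b then B i b - t * B i a else B i (q i))"
        if "i \<in> S" for i q
        using that insert.hyps(2) by (auto simp: A'_def B_def)
      then show ?thesis
        unfolding permanent_on_def by (intro sum.cong prod.cong refl) auto
    qed
    moreover have "\<dots> = permanent_on S (\<lambda>k l. if l = b then B k b else B k l) - t * P b"
      unfolding P_def by (rule permanent_on_column_diff) (use insert.hyps b in auto)
    moreover have "(\<lambda>k l. if l = b then B k b else B k l) = B"
      by (auto simp: fun_eq_iff)
    ultimately show ?thesis
      by (simp add: P_a)
  qed
  have "P a \<noteq> 0"
    using insert.IH[of A] row unfolding P_a B_def
    by (metis (no_types, lifting) insertCI le_add_same_cancel2 norm_ge_zero order_le_less_trans)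
  have le: "cmod (P b) \<le> cmod (P a)" if "b \<in> insert a S" for b
  proof (cases "b = a")
    case False
    show ?thesis
    proof (rule ccontr)
      assume "\<not> ?thesis"
      \<comment> \<open>If \<open>P b\<close> were larger than \<open>P a\<close> in modulus, the
        quotient \<open>P a / P b\<close> would be an admissible \<open>t\<close> at which the
        difference vanishes.\<close>
      then show False
        using nonzero[of b "P a / P b"] that False by (cases "P b = 0") (auto simp: norm_divide)
    qed
  qed simp
  have "permanent_on (insert a S) B = (\<Sum>b\<in>insert a S. B a b * P b)"
    unfolding P_def by (rule permanent_on_insert) (use insert.hyps in auto)
  \<comment> \<open>The 1 in the diagonal entry \<open>B a a\<close> contributes the separate
    summand \<open>P a\<close>.\<close>
  also have "\<dots> = P a + (\<Sum>b\<in>insert a S. A a b * P b)"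
  proof -
    have "(\<Sum>b\<in>S. B a b * P b) = (\<Sum>b\<in>S. A a b * P b)"
      using insert.hyps by (intro sum.cong) (auto simp: B_def)
    then show ?thesis
      using insert.hyps by (simp add: B_def algebra_simps)
  qed
  finally have expand: "permanent_on (insert a S) B = P a + (\<Sum>b\<in>insert a S. A a b * P b)" .
  have "cmod (\<Sum>b\<in>insert a S. A a b * P b) \<le> (\<Sum>b\<in>insert a S. cmod (A a b) * cmod (P a))"
    by (intro sum_norm_le) (simp add: norm_mult mult_left_mono le)
  also have "\<dots> = (\<Sum>b\<in>insert a S. cmod (A a b)) * cmod (P a)"
    by (simp add: sum_distrib_right)
  also have "\<dots> < cmod (P a)"
    using insert.prems[of a] \<open>P a \<noteq> 0\<close> by simp
  finally have "permanent_on (insert a S) B \<noteq> 0"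
    unfolding expand by (metis add_eq_0_iff norm_minus_cancel order_less_irrefl)
  then show ?case by (simp add: B_def)
qed

lemma permanent_on_identity:
  assumes "finite S"
  shows "permanent_on S (\<lambda>i j. of_bool (i = j)) = 1"
proof -
  have "(\<Prod>i\<in>S. of_bool (i = \<sigma> i)) = (of_bool (\<sigma> = id) :: 'b)" if "\<sigma> permutes S" for \<sigma>
  proof (cases "\<sigma> = id")
    case False
    then obtain i where "\<sigma> i \<noteq> i" by (auto simp: fun_eq_iff)
    with that have "i \<in> S" by (metis permutes_not_in)
    with False \<open>\<sigma> i \<noteq> i\<close> assms show ?thesis
      by (auto intro!: prod_zero bexI[of _ i])
  qed simp
  then have "permanent_on S (\<lambda>i j. of_bool (i = j)) =
      (\<Sum>\<sigma> | \<sigma> permutes S. of_bool (\<sigma> = id) :: 'b)"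
    unfolding permanent_on_def by (intro sum.cong) auto
  also have "\<dots> = 1"
    using assms by (simp add: of_bool_def finite_permutations)
  finally show ?thesis .
qed

subsection \<open>Polynomials in the matrix entries\<close>

definition monom_eval :: "((nat \<times> nat) \<Rightarrow>\<^sub>0 nat) \<Rightarrow> complex mat \<Rightarrow> complex" where
  "monom_eval m A = (\<Prod>v\<in>Poly_Mapping.keys m. (A $$ v) ^ Poly_Mapping.lookup m v)"

definition monom_degree :: "('a \<Rightarrow>\<^sub>0 nat) \<Rightarrow> nat" where
  "monom_degree m = (\<Sum>v\<in>Poly_Mapping.keys m. Poly_Mapping.lookup m v)"

lemma monom_eval_superset:
  assumes "finite V" "Poly_Mapping.keys m \<subseteq> V"
  shows "monom_eval m A = (\<Prod>v\<in>V. (A $$ v) ^ Poly_Mapping.lookup m v)"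
  unfolding monom_eval_def using assms
  by (intro prod.mono_neutral_left) (auto simp: in_keys_iff)

lemma monom_degree_superset:
  assumes "finite V" "Poly_Mapping.keys m \<subseteq> V"
  shows "monom_degree m = (\<Sum>v\<in>V. Poly_Mapping.lookup m v)"
  unfolding monom_degree_def using assms
  by (intro sum.mono_neutral_left) (auto simp: in_keys_iff)

lemma monom_eval_add: "monom_eval (m + m') A = monom_eval m A * monom_eval m' A"
proof -
  let ?V = "Poly_Mapping.keys m \<union> Poly_Mapping.keys m'"
  have "monom_eval x A = (\<Prod>v\<in>?V. (A $$ v) ^ Poly_Mapping.lookup x v)" if "x \<in> {m, m', m + m'}" for x
    using that Poly_Mapping.keys_add[of m m'] by (intro monom_eval_superset) auto
  then show ?thesis
    by (simp add: lookup_add power_add prod.distrib)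
qed

lemma monom_degree_add: "monom_degree (m + m') = monom_degree m + monom_degree m'"
proof -
  let ?V = "Poly_Mapping.keys m \<union> Poly_Mapping.keys m'"
  have "monom_degree x = (\<Sum>v\<in>?V. Poly_Mapping.lookup x v)" if "x \<in> {m, m', m + m'}" for x
    using that Poly_Mapping.keys_add[of m m'] by (intro monom_degree_superset) auto
  then show ?thesis
    by (simp add: lookup_add sum.distrib)
qed

lemma total_degree_le_iff:
  "total_degree p \<le> d \<longleftrightarrow> (\<forall>m\<in>Poly_Mapping.keys p. monom_degree m \<le> d)"
  by (simp add: total_degree_def monom_degree_def)

text \<open>Cancellation can remove monomials from a sum of polynomials. Over a common superset of
  the supports, evaluations can still be compared term by term.\<close>

lemma eval_poly_superset:
  assumes "finite M" "Poly_Mapping.keys p \<subseteq> M"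
  shows "eval_poly p A = (\<Sum>m\<in>M. Poly_Mapping.lookup p m * monom_eval m A)"
  unfolding eval_poly_def monom_eval_def[symmetric] using assms
  by (intro sum.mono_neutral_left) (auto simp: in_keys_iff)

lemma eval_poly_add: "eval_poly (p + q) A = eval_poly p A + eval_poly q A"
proof -
  let ?M = "Poly_Mapping.keys p \<union> Poly_Mapping.keys q"
  have "eval_poly x A = (\<Sum>m\<in>?M. Poly_Mapping.lookup x m * monom_eval m A)" if "x \<in> {p, q, p + q}" for x
    using that Poly_Mapping.keys_add[of p q] by (intro eval_poly_superset) auto
  then show ?thesis
    by (simp add: lookup_add sum.distrib algebra_simps)
qed

text \<open>A predicate on functions, so that later arguments use closure properties instead of
  computing with \<open>entry_poly\<close>. The equation ranges over matrices of every dimension;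
  the bound on the variables is what ties it to size \<open>n\<close>.\<close>

definition entry_polynomial :: "nat \<Rightarrow> nat \<Rightarrow> (complex mat \<Rightarrow> complex) \<Rightarrow> bool" where
  "entry_polynomial n d f \<longleftrightarrow>
     (\<exists>p. poly_vars p \<subseteq> {0..<n} \<times> {0..<n} \<and> total_degree p \<le> d \<and> (\<forall>A. f A = eval_poly p A))"

lemma entry_polynomial_monom:
  assumes "Poly_Mapping.keys m \<subseteq> {0..<n} \<times> {0..<n}" "monom_degree m \<le> d"
  shows "entry_polynomial n d (\<lambda>A. c * monom_eval m A)"
proof -
  let ?p = "Poly_Mapping.single m c"
  have "Poly_Mapping.keys ?p \<subseteq> {m}" by simp
  then have "c * monom_eval m A = eval_poly ?p A" for A
    by (subst eval_poly_superset[of "{m}"]) auto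
  moreover have "poly_vars ?p \<subseteq> {0..<n} \<times> {0..<n}"
    using assms \<open>Poly_Mapping.keys ?p \<subseteq> {m}\<close> unfolding poly_vars_def by blast
  moreover have "total_degree ?p \<le> d"
    using assms \<open>Poly_Mapping.keys ?p \<subseteq> {m}\<close> unfolding total_degree_le_iff by blast
  ultimately show ?thesis
    unfolding entry_polynomial_def by blast
qed

lemma entry_polynomial_const: "entry_polynomial n d (\<lambda>A. c)"
  using entry_polynomial_monom[of 0 n d c] by (simp add: monom_eval_def monom_degree_def)

lemma entry_polynomial_entry:
  assumes "i < n" "j < n" "d \<ge> 1"
  shows "entry_polynomial n d (\<lambda>A. A $$ (i, j))"
  using entry_polynomial_monom[of "Poly_Mapping.single (i, j) 1" n d 1] assms
  by (simp add: monom_eval_def monom_degree_def)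

lemma entry_polynomial_add:
  assumes "entry_polynomial n d f" "entry_polynomial n d g"
  shows "entry_polynomial n d (\<lambda>A. f A + g A)"
proof -
  obtain p q where
    p: "poly_vars p \<subseteq> {0..<n} \<times> {0..<n}" "total_degree p \<le> d" "\<And>A. f A = eval_poly p A" and
    q: "poly_vars q \<subseteq> {0..<n} \<times> {0..<n}" "total_degree q \<le> d" "\<And>A. g A = eval_poly q A"
    using assms unfolding entry_polynomial_def by auto
  have "Poly_Mapping.keys (p + q) \<subseteq> Poly_Mapping.keys p \<union> Poly_Mapping.keys q"
    by (rule Poly_Mapping.keys_add)
  with p(1,2) q(1,2) have "poly_vars (p + q) \<subseteq> {0..<n} \<times> {0..<n} \<and> total_degree (p + q) \<le> d"
    unfolding poly_vars_def total_degree_le_iff by blast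
  then show ?thesis
    unfolding entry_polynomial_def p(3) q(3) eval_poly_add[symmetric] by blast
qed

lemma entry_polynomial_sum:
  assumes "\<And>i. i \<in> I \<Longrightarrow> entry_polynomial n d (f i)"
  shows "entry_polynomial n d (\<lambda>A. \<Sum>i\<in>I. f i A)"
  using assms
  by (induction I rule: infinite_finite_induct) (auto intro: entry_polynomial_const entry_polynomial_add)

text \<open>The product expands into a double sum of monomials \<open>m + m'\<close>, each of degree
  at most \<open>d + e\<close>, and closure under sums finishes.\<close>

lemma entry_polynomial_mult:
  assumes "entry_polynomial n d f" "entry_polynomial n e g"
  shows "entry_polynomial n (d + e) (\<lambda>A. f A * g A)"
proof -
  obtain p q where
    p: "poly_vars p \<subseteq> {0..<n} \<times> {0..<n}" "total_degree p \<le> d" "\<And>A. f A = eval_poly p A" and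
    q: "poly_vars q \<subseteq> {0..<n} \<times> {0..<n}" "total_degree q \<le> e" "\<And>A. g A = eval_poly q A"
    using assms unfolding entry_polynomial_def by auto
  let ?P = "Poly_Mapping.keys p" and ?Q = "Poly_Mapping.keys q"
  have "f A * g A = (\<Sum>m\<in>?P. \<Sum>m'\<in>?Q. (Poly_Mapping.lookup p m * Poly_Mapping.lookup q m') *
      monom_eval (m + m') A)" for A
    unfolding p(3) q(3) eval_poly_def monom_eval_def[symmetric] sum_product monom_eval_add
    by (simp add: mult_ac)
  moreover have "entry_polynomial n (d + e)
     (\<lambda>A. (Poly_Mapping.lookup p m * Poly_Mapping.lookup q m') * monom_eval (m + m') A)"
    if m: "m \<in> ?P" "m' \<in> ?Q" for m m'
  proof (rule entry_polynomial_monom)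
    show "Poly_Mapping.keys (m + m') \<subseteq> {0..<n} \<times> {0..<n}"
      using m p(1) q(1) Poly_Mapping.keys_add[of m m'] unfolding poly_vars_def by blast
    show "monom_degree (m + m') \<le> d + e"
      using m p(2) q(2) by (simp add: total_degree_le_iff monom_degree_add add_mono)
  qed
  ultimately show ?thesis
    by (simp add: entry_polynomial_sum)
qed

lemma entry_polynomial_cmult:
  "entry_polynomial n d f \<Longrightarrow> entry_polynomial n d (\<lambda>A. c * f A)"
  using entry_polynomial_mult[OF entry_polynomial_const[of n 0 c]] by simp

lemma entry_polynomial_diff:
  assumes "entry_polynomial n d f" "entry_polynomial n d g"
  shows "entry_polynomial n d (\<lambda>A. f A - g A)"
  using entry_polynomial_add[OF assms(1) entry_polynomial_cmult[OF assms(2), of "-1"]] by simp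

text \<open>All variables lie in the index range of the matrix, where the entries of
  \<open>Matrix.mat n n a\<close> are coordinates of \<open>a\<close>; the function is therefore a
  polynomial in finitely many continuous coordinates.\<close>

lemma continuous_on_entry_polynomial:
  assumes "entry_polynomial n d f"
  shows "continuous_on X (\<lambda>a. f (Matrix.mat n n a))"
proof -
  obtain p where p: "poly_vars p \<subseteq> {0..<n} \<times> {0..<n}" "\<And>A. f A = eval_poly p A"
    using assms unfolding entry_polynomial_def by blast
  have "f (Matrix.mat n n a) =
      (\<Sum>m\<in>Poly_Mapping.keys p. Poly_Mapping.lookup p m *
         (\<Prod>v\<in>Poly_Mapping.keys m. a v ^ Poly_Mapping.lookup m v))" for a
  proof -
    have "Matrix.mat n n a $$ v = a v" if "m \<in> Poly_Mapping.keys p" "v \<in> Poly_Mapping.keys m" for m v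
    proof -
      have "v \<in> {0..<n} \<times> {0..<n}" using p(1) that unfolding poly_vars_def by blast
      then show ?thesis by auto
    qed
    then show ?thesis
      unfolding p(2) eval_poly_def by (intro sum.cong arg_cong2[where f = "(*)"] prod.cong) auto
  qed
  moreover have "continuous_on X (\<lambda>a :: nat \<times> nat \<Rightarrow> complex. a v)" for v
    by (rule continuous_on_subset[OF continuous_on_product_coordinates]) simp
  ultimately show ?thesis
    by (auto intro!: continuous_intros)
qed

subsection \<open>The permanent along a line through the identity\<close>

text \<open>The power of the polynomial variable bounds the degree in the entries. Cauchy products
  preserve this, since the degrees \<open>i\<close> and \<open>k - i\<close> add up to
  \<open>k\<close>.\<close>

definition graded_in_entries :: "nat \<Rightarrow> (complex mat \<Rightarrow> complex poly) \<Rightarrow> bool" where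
  "graded_in_entries n p \<longleftrightarrow> (\<forall>k. entry_polynomial n k (\<lambda>A. coeff (p A) k))"

lemma graded_in_entries_sum:
  "(\<And>i. i \<in> I \<Longrightarrow> graded_in_entries n (p i)) \<Longrightarrow> graded_in_entries n (\<lambda>A. \<Sum>i\<in>I. p i A)"
  unfolding graded_in_entries_def by (auto simp: coeff_sum intro: entry_polynomial_sum)

lemma graded_in_entries_mult:
  assumes "graded_in_entries n p" "graded_in_entries n q"
  shows "graded_in_entries n (\<lambda>A. p A * q A)"
  unfolding graded_in_entries_def coeff_mult
proof (intro allI entry_polynomial_sum)
  fix k i :: nat assume "i \<in> {..k}"
  then show "entry_polynomial n k (\<lambda>A. coeff (p A) i * coeff (q A) (k - i))"
    using entry_polynomial_mult[of n i _ "k - i"] assms unfolding graded_in_entries_def by fastforce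
qed

lemma graded_in_entries_prod:
  "(\<And>i. i \<in> I \<Longrightarrow> graded_in_entries n (p i)) \<Longrightarrow> graded_in_entries n (\<lambda>A. \<Prod>i\<in>I. p i A)"
proof (induction I rule: infinite_finite_induct)
  case (insert i I)
  then show ?case by (auto intro: graded_in_entries_mult)
qed (simp_all add: graded_in_entries_def entry_polynomial_const)

lemma graded_in_entries_linear:
  assumes "i < n" "j < n"
  shows "graded_in_entries n (\<lambda>A. [:c, A $$ (i, j):])"
  unfolding graded_in_entries_def
proof
  fix k :: nat
  show "entry_polynomial n k (\<lambda>A. coeff [:c, A $$ (i, j):] k)"
    using assms
    by (cases k; cases "k - 1") (auto intro: entry_polynomial_const entry_polynomial_entry)
qed

text \<open>The polynomial g of the overview, with z as the polynomial variable.\<close>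

definition per_poly :: "nat \<Rightarrow> complex mat \<Rightarrow> complex poly" where
  "per_poly n A = permanent_on {0..<n} (\<lambda>i j. [:of_bool (i = j), A $$ (i, j):])"

lemma graded_in_entries_per_poly: "graded_in_entries n (per_poly n)"
proof -
  have "\<sigma> i < n" if "\<sigma> permutes {0..<n}" "i < n" for \<sigma> i
    using permutes_in_image[OF that(1), of i] that(2) by simp
  then show ?thesis
    unfolding per_poly_def permanent_on_def
    by (intro graded_in_entries_sum graded_in_entries_prod graded_in_entries_linear) auto
qed

lemma poly_per_poly:
  "poly (per_poly n A) z = permanent_on {0..<n} (\<lambda>i j. of_bool (i = j) + z * A $$ (i, j))"
  by (simp add: per_poly_def permanent_on_def poly_sum poly_prod)

lemma poly_per_poly_0: "poly (per_poly n A) 0 = 1"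
  by (simp add: poly_per_poly permanent_on_identity)

lemma poly_per_poly_1:
  assumes "A \<in> carrier_mat n n"
  shows "poly (per_poly n A) 1 = permanent (1\<^sub>m n + A)"
proof -
  have "(1\<^sub>m n + A) $$ (i, \<sigma> i) = of_bool (i = \<sigma> i) + A $$ (i, \<sigma> i)"
    if "\<sigma> permutes {0..<n}" "i \<in> {0..<n}" for \<sigma> i
    using permutes_in_image[OF that(1), of i] that(2) assms by auto
  then show ?thesis
    using assms unfolding poly_per_poly permanent_on_def permanent_def
    by (intro sum.cong prod.cong) auto
qed

lemma degree_per_poly: "degree (per_poly n A) \<le> n"
  unfolding per_poly_def permanent_on_def
proof (rule degree_sum_le)
  fix \<sigma> :: "nat \<Rightarrow> nat"
  have "degree (\<Prod>i\<in>{0..<n}. [:of_bool (i = \<sigma> i), A $$ (i, \<sigma> i):]) \<le>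
      (\<Sum>i\<in>{0..<n}. degree [:of_bool (i = \<sigma> i), A $$ (i, \<sigma> i):])"
    using degree_prod_sum_le[of "{0..<n}" "\<lambda>i. [:of_bool (i = \<sigma> i), A $$ (i, \<sigma> i):]"]
    by (simp add: o_def)
  also have "\<dots> \<le> (\<Sum>i\<in>{0..<n}. 1)"
    by (intro sum_mono) simp
  finally show "degree (\<Prod>i\<in>{0..<n}. [:of_bool (i = \<sigma> i), A $$ (i, \<sigma> i):]) \<le> n"
    by simp
qed (simp add: finite_permutations)

subsection \<open>Logarithmic derivatives of polynomials\<close>

text \<open>The value 1 at 0 excludes the root 0, so each factor z - x equals -x (1 - z/x). The
  scalars collected this way multiply to 1, again by the value at 0. The \<open>w\<close> are the
  reciprocals of the roots.\<close>

lemma poly_factorization_at_0: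
  fixes p :: "'a :: alg_closed_field poly"
  assumes "poly p 0 = 1"
  obtains M where "size M = degree p" "p = (\<Prod>w\<in>#M. [:1, -w:])"
proof -
  have "p \<noteq> 0" using assms by auto
  then obtain N where N: "size N = degree p" "p = smult (lead_coeff p) (\<Prod>x\<in>#N. [:-x, 1:])"
    using alg_closed_imp_factorization by blast
  \<comment> \<open>The leading coefficient is generalised to any \<open>c\<close>, so that the
    induction can absorb the scalar \<open>-x\<close> of each factor.\<close>
  have "smult c (\<Prod>x\<in>#N. [:-x, 1:]) = (\<Prod>w\<in>#image_mset inverse N. [:1, -w:])"
    if "poly (smult c (\<Prod>x\<in>#N. [:-x, 1:])) 0 = 1" for c and N :: "'a multiset"
    using that
  proof (induction N arbitrary: c)
    case empty
    then show ?case by simp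
  next
    case (add x N)
    have "x \<noteq> 0" using add.prems by auto
    then have "[:-x, 1:] = smult (-x) [:1, -inverse x:]" by simp
    then have "smult c (\<Prod>x\<in>#add_mset x N. [:-x, 1:]) =
        smult c (smult (-x) [:1, -inverse x:] * (\<Prod>x\<in>#N. [:-x, 1:]))"
      by (simp only: image_mset_add_mset prod_mset.add_mset)
    also have "\<dots> = [:1, -inverse x:] * smult (- c * x) (\<Prod>x\<in>#N. [:-x, 1:])"
      by (simp only: mult_smult_left mult_smult_right smult_smult) simp
    also have "smult (- c * x) (\<Prod>x\<in>#N. [:-x, 1:]) = (\<Prod>w\<in>#image_mset inverse N. [:1, -w:])"
      using add.prems by (intro add.IH) (simp add: mult_ac)
    finally show ?case by simp
  qed
  from this[of "lead_coeff p" N] N assms have "p = (\<Prod>w\<in>#image_mset inverse N. [:1, -w:])"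
    by metis
  then show ?thesis
    using that[of "image_mset inverse N"] N(1) by simp
qed

text \<open>The logarithmic derivative F'/F is the sum of the terms -w / (1 - w z), expanded as
  geometric series. Multiplying by F avoids division.\<close>

lemma fps_deriv_prod_linear:
  fixes M :: "'a :: field multiset"
  defines "F \<equiv> \<lambda>M. fps_of_poly (\<Prod>w\<in>#M. [:1, -w:])"
  shows "fps_deriv (F M) = Abs_fps (\<lambda>k. - (\<Sum>w\<in>#M. w ^ Suc k)) * F M"
proof (induction M)
  case empty
  have "Abs_fps (\<lambda>k. 0) = (0 :: 'a fps)" by (simp add: fps_eq_iff)
  then show ?case by (simp add: F_def)
next
  case (add w M)
  let ?S = "Abs_fps (\<lambda>k. - (\<Sum>w\<in>#M. w ^ Suc k))" and ?T = "Abs_fps (\<lambda>k. - (w ^ Suc k))"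
  let ?l = "1 - fps_const w * fps_X"
  have F: "F (add_mset w M) = ?l * F M"
    by (simp only: F_def image_mset_add_mset prod_mset.add_mset fps_of_poly_mult fps_of_poly_linear')
      simp
  have T: "?T * ?l = - fps_const w"
  proof (rule fps_ext)
    fix k show "fps_nth (?T * ?l) k = fps_nth (- fps_const w) k"
      by (cases k) (simp_all add: right_diff_distrib mult.assoc[symmetric] fps_mult_right_const_nth)
  qed
  have "Abs_fps (\<lambda>k. - (\<Sum>w\<in>#add_mset w M. w ^ Suc k)) = ?T + ?S"
    by (simp add: fps_eq_iff)
  then have "Abs_fps (\<lambda>k. - (\<Sum>w\<in>#add_mset w M. w ^ Suc k)) * F (add_mset w M) =
      (?T * ?l) * F M + ?l * (?S * F M)"
    by (simp add: F algebra_simps)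
  also have "\<dots> = fps_deriv (F (add_mset w M))"
    unfolding T F add.IH[symmetric] by simp
  finally show ?case by simp
qed

text \<open>Coefficients of the formal series g'/g; index \<open>k\<close> belongs to the power sum
  of order \<open>k + 1\<close>.\<close>

definition log_deriv_coeff :: "complex poly \<Rightarrow> nat \<Rightarrow> complex" where
  "log_deriv_coeff p k = fps_nth (fps_deriv (fps_of_poly p) * inverse (fps_of_poly p)) k"

lemma log_deriv_coeff_prod_linear:
  "log_deriv_coeff (\<Prod>w\<in>#M. [:1, -w:]) k = - (\<Sum>w\<in>#M. w ^ Suc k)"
proof -
  let ?p = "\<Prod>w\<in>#M. [:1, -w:] :: complex poly"
  have "poly ?p 0 = 1"
    by (induction M) auto
  then have "fps_of_poly ?p * inverse (fps_of_poly ?p) = 1"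
    by (intro inverse_mult_eq_1') (simp add: poly_0_coeff_0)
  then show ?thesis
    unfolding log_deriv_coeff_def fps_deriv_prod_linear mult.assoc by simp
qed

text \<open>Newton's identities, read off by comparing coefficients in (p'/p) p = p'.\<close>

lemma log_deriv_coeff_recurrence:
  assumes "coeff p 0 = 1"
  shows "log_deriv_coeff p k =
    of_nat (Suc k) * coeff p (Suc k) - (\<Sum>i<k. log_deriv_coeff p i * coeff p (k - i))"
proof -
  have "fps_deriv (fps_of_poly p) * inverse (fps_of_poly p) * fps_of_poly p = fps_deriv (fps_of_poly p)"
    using assms by (simp add: mult.assoc inverse_mult_eq_1)
  then have "(\<Sum>i\<le>k. log_deriv_coeff p i * coeff p (k - i)) = of_nat (Suc k) * coeff p (Suc k)"
    unfolding fps_eq_iff fps_mult_nth[of _ "fps_of_poly p"]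
    by (simp add: log_deriv_coeff_def atMost_atLeast0)
  then show ?thesis
    using assms by (simp add: lessThan_Suc_atMost[symmetric] algebra_simps)
qed

text \<open>Strong induction along Newton's identities: the degrees \<open>Suc i\<close> and
  \<open>k - i\<close> of the two factors add up to \<open>Suc k\<close>.\<close>

lemma entry_polynomial_log_deriv_coeff:
  "entry_polynomial n (Suc k) (\<lambda>A. log_deriv_coeff (per_poly n A) k)"
proof (induction k rule: less_induct)
  case (less k)
  have coeff: "entry_polynomial n j (\<lambda>A. coeff (per_poly n A) j)" for j
    using graded_in_entries_per_poly unfolding graded_in_entries_def by simp
  have "coeff (per_poly n A) 0 = 1" for A
    using poly_per_poly_0[of n A] by (simp add: poly_0_coeff_0)
  moreover have "entry_polynomial n (Suc k)
      (\<lambda>A. log_deriv_coeff (per_poly n A) i * coeff (per_poly n A) (k - i))" if "i < k" for i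
    using entry_polynomial_mult[OF less.IH[OF that] coeff[of "k - i"]] that by simp
  ultimately show ?case
    by (subst log_deriv_coeff_recurrence)
      (auto intro!: entry_polynomial_diff entry_polynomial_sum entry_polynomial_cmult coeff
        simp del: of_nat_Suc)
qed


subsection \<open>The logarithm of the permanent as a power series\<close>

text \<open>A factor with \<open>cmod w > r\<close> would give the root \<open>1 / w\<close>. There
  the matrix A / w has row sums below 1, so its perturbation of the identity has non-zero
  permanent.\<close>

lemma per_poly_factorization:
  assumes "0 \<le> r" "\<And>i. i < n \<Longrightarrow> (\<Sum>j<n. cmod (A $$ (i, j))) \<le> r"
  obtains M where "size M \<le> n" "per_poly n A = (\<Prod>w\<in>#M. [:1, -w:])" "\<And>w. w \<in># M \<Longrightarrow> cmod w \<le> r"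
proof -
  obtain M where M: "size M = degree (per_poly n A)" "per_poly n A = (\<Prod>w\<in>#M. [:1, -w:])"
    using poly_factorization_at_0[OF poly_per_poly_0] by blast
  have "cmod w \<le> r" if w: "w \<in># M" for w
  proof (rule ccontr)
    assume "\<not> cmod w \<le> r"
    with assms(1) have "r < cmod w" "w \<noteq> 0" by auto
    have "permanent_on {0..<n} (\<lambda>i j. of_bool (i = j) + (1 / w) * A $$ (i, j)) \<noteq> 0"
    proof (rule permanent_on_row_dominated_nonzero)
      fix i assume "i \<in> {0..<n}"
      then have "(\<Sum>j<n. cmod (A $$ (i, j))) < cmod w"
        using assms(2)[of i] \<open>r < cmod w\<close> by simp
      then show "(\<Sum>j\<in>{0..<n}. cmod ((1 / w) * A $$ (i, j))) < 1"
        using \<open>w \<noteq> 0\<close>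
        by (simp add: norm_divide sum_divide_distrib[symmetric] atLeast0LessThan)
    qed simp
    moreover have "poly (per_poly n A) (1 / w) = 0"
    proof -
      obtain M' where "M = add_mset w M'" using w by (metis insert_DiffM)
      then show ?thesis using \<open>w \<noteq> 0\<close> by (simp add: M(2))
    qed
    ultimately show False by (simp add: poly_per_poly)
  qed
  then show ?thesis
    using that[of M] M degree_per_poly[of n A] by simp
qed

lemma norm_log_deriv_coeff_le:
  assumes "0 \<le> r" "\<And>i. i < n \<Longrightarrow> (\<Sum>j<n. cmod (A $$ (i, j))) \<le> r"
  shows "cmod (log_deriv_coeff (per_poly n A) k) \<le> real n * r ^ Suc k"
proof -
  obtain M where M: "size M \<le> n" "per_poly n A = (\<Prod>w\<in>#M. [:1, -w:])"
    "\<And>w. w \<in># M \<Longrightarrow> cmod w \<le> r"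
    using per_poly_factorization[OF assms] by blast
  from M(3) have "cmod (\<Sum>w\<in>#M. w ^ Suc k) \<le> real (size M) * r ^ Suc k"
  proof (induction M)
    case (add w M)
    have "cmod (w ^ Suc k) \<le> r ^ Suc k"
      using add.prems[of w] by (simp only: norm_power) (simp add: power_mono del: power_Suc)
    moreover have "cmod (\<Sum>w\<in>#M. w ^ Suc k) \<le> real (size M) * r ^ Suc k"
      using add by simp
    ultimately show ?case
      using norm_triangle_ineq[of "w ^ Suc k" "\<Sum>w\<in>#M. w ^ Suc k"]
      by (simp add: distrib_right del: power_Suc)
  qed simp
  also have "\<dots> \<le> real n * r ^ Suc k"
    using M(1) assms(1) by (intro mult_right_mono) auto
  finally show ?thesis
    by (simp only: M(2) log_deriv_coeff_prod_linear norm_minus_cancel)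
qed

text \<open>The coefficient of z^(k+1) in ln g, by integrating g'/g termwise. The shift is harmless
  because ln g has constant term 0.\<close>

definition log_per_coeff :: "nat \<Rightarrow> nat \<Rightarrow> complex mat \<Rightarrow> complex" where
  "log_per_coeff n k A = inverse (of_nat (Suc k)) * log_deriv_coeff (per_poly n A) k"

definition per_log :: "nat \<Rightarrow> complex mat \<Rightarrow> complex" where
  "per_log n A = suminf (\<lambda>k. log_per_coeff n k A)"

lemma entry_polynomial_log_per_coeff: "entry_polynomial n (Suc k) (log_per_coeff n k)"
  unfolding log_per_coeff_def[abs_def]
  by (intro entry_polynomial_cmult entry_polynomial_log_deriv_coeff)

lemma norm_log_per_coeff_le:
  assumes "0 \<le> r" "\<And>i. i < n \<Longrightarrow> (\<Sum>j<n. cmod (A $$ (i, j))) \<le> r"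
  shows "cmod (log_per_coeff n k A) \<le> real n * r ^ Suc k"
proof -
  have "cmod (log_per_coeff n k A) = inverse (real (Suc k)) * cmod (log_deriv_coeff (per_poly n A) k)"
    unfolding log_per_coeff_def norm_mult norm_inverse norm_of_nat ..
  also have "\<dots> \<le> 1 * cmod (log_deriv_coeff (per_poly n A) k)"
    by (intro mult_right_mono) (auto simp: field_simps)
  also have "\<dots> \<le> real n * r ^ Suc k"
    using norm_log_deriv_coeff_le[OF assms] by simp
  finally show ?thesis .
qed

text \<open>By the factorization, the series is a finite sum of the series of
  \<open>ln (1 - w)\<close> with \<open>cmod w < 1\<close>. Exponentiating gives the product of the
  \<open>1 - w\<close>, which is the value at 1.\<close>

lemma exp_per_log:
  assumes "0 \<le> r" "r < 1" "\<And>i. i < n \<Longrightarrow> (\<Sum>j<n. cmod (A $$ (i, j))) \<le> r"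
  shows "exp (per_log n A) = poly (per_poly n A) 1"
proof -
  obtain M where M: "per_poly n A = (\<Prod>w\<in>#M. [:1, -w:])" "\<And>w. w \<in># M \<Longrightarrow> cmod w < 1"
    using per_poly_factorization[of r n A] assms by (metis order_le_less_trans)
  \<comment> \<open>The library series starts at \<open>k = 0\<close>, where division by zero makes
    the term 0, so shifting the index leaves the limit unchanged.\<close>
  have single: "(\<lambda>k. inverse (of_nat (Suc k)) * - (w ^ Suc k)) sums ln (1 - w)" if "cmod w < 1" for w :: complex
    using Ln_series'[of "-w"] that sums_Suc_iff[of "\<lambda>k. - (w ^ k) / of_nat k" "ln (1 - w)"]
    by (simp add: divide_inverse mult.commute del: of_nat_Suc power_Suc)
  from M(2) have "(\<lambda>k. inverse (of_nat (Suc k)) * - (\<Sum>w\<in>#M. w ^ Suc k)) sums (\<Sum>w\<in>#M. ln (1 - w)) \<and>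
      exp (\<Sum>w\<in>#M. ln (1 - w)) = poly (\<Prod>w\<in>#M. [:1, -w:]) 1"
  proof (induction M)
    case (add w M)
    have "cmod w < 1" using add.prems by simp
    then have "1 - w \<noteq> 0" by auto
    then have "exp (\<Sum>w\<in>#add_mset w M. ln (1 - w)) = poly (\<Prod>w\<in>#add_mset w M. [:1, -w:]) 1"
      using add by (simp add: exp_add algebra_simps)
    moreover have "(\<lambda>k. inverse (of_nat (Suc k)) * - (\<Sum>w\<in>#add_mset w M. w ^ Suc k))
        sums (\<Sum>w\<in>#add_mset w M. ln (1 - w))"
    proof -
      have "(\<lambda>k. inverse (of_nat (Suc k)) * - (\<Sum>w\<in>#M. w ^ Suc k)) sums (\<Sum>w\<in>#M. ln (1 - w))"
        using add by simp
      from sums_add[OF single[OF \<open>cmod w < 1\<close>] this] show ?thesis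
        by (simp only: image_mset_add_mset sum_mset.add_mset minus_add_distrib distrib_left)
    qed
    ultimately show ?case by blast
  qed simp
  then show ?thesis
    unfolding per_log_def log_per_coeff_def M(1) log_deriv_coeff_prod_linear
    by (elim conjE) (simp only: sums_unique[symmetric])
qed

section \<open>Existence and uniqueness of the branch\<close>

text \<open>There are finitely many rows, so the largest row sum stays below 1; the midpoint between
  it and 1 restores the strict inequality. Inserting 0 into the maximum covers
  \<open>n = 0\<close>.\<close>

lemma row_dominated_uniform:
  assumes "A \<in> row_dominated n"
  obtains r where "0 < r" "r < 1" "\<And>i. i < n \<Longrightarrow> (\<Sum>j<n. cmod (A $$ (i, j))) < r"
proof -
  define s where "s = Max (insert 0 ((\<lambda>i. \<Sum>j<n. cmod (A $$ (i, j))) ` {..<n}))"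
  have "0 \<le> s" and le: "\<And>i. i < n \<Longrightarrow> (\<Sum>j<n. cmod (A $$ (i, j))) \<le> s"
    unfolding s_def by (auto intro!: Max_ge)
  have "s < 1"
    unfolding s_def using assms by (auto simp: row_dominated_def)
  show ?thesis
  proof (rule that[of "(s + 1) / 2"])
    fix i assume "i < n"
    with le[of i] \<open>s < 1\<close> show "(\<Sum>j<n. cmod (A $$ (i, j))) < (s + 1) / 2" by simp
  qed (use \<open>0 \<le> s\<close> \<open>s < 1\<close> in auto)
qed

lemma is_ln_per_branch_per_log: "is_ln_per_branch n (per_log n)"
  unfolding is_ln_per_branch_def
proof (intro conjI ballI)
  \<comment> \<open>The M-test needs a common bound \<open>r < 1\<close> on the row sums. The domain
    is the union of the open sets \<open>U r\<close>, and continuity on each of them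
    suffices.\<close>
  define U where "U r = {a :: nat \<times> nat \<Rightarrow> complex. \<forall>i<n. (\<Sum>j<n. cmod (a (i, j))) < r}" for r
  have "{a. Matrix.mat n n a \<in> row_dominated n} = (\<Union>r\<in>{0<..<1}. U r)"
  proof (intro equalityI subsetI)
    fix a :: "nat \<times> nat \<Rightarrow> complex" assume "a \<in> {a. Matrix.mat n n a \<in> row_dominated n}"
    then obtain r where "0 < r" "r < 1"
      "\<And>i. i < n \<Longrightarrow> (\<Sum>j<n. cmod (Matrix.mat n n a $$ (i, j))) < r"
      using row_dominated_uniform[of "Matrix.mat n n a" n] by auto
    then show "a \<in> (\<Union>r\<in>{0<..<1}. U r)"
      unfolding U_def by (intro UN_I[of r]) auto
  qed (auto simp: U_def row_dominated_def)
  moreover have "open (U r)" for r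
  proof -
    have "continuous_on UNIV (\<lambda>a :: nat \<times> nat \<Rightarrow> complex. \<Sum>j<n. cmod (a (i, j)))" for i
      by (intro continuous_intros continuous_on_product_coordinates)
    then have "open (\<Inter>i\<in>{..<n}. {a :: nat \<times> nat \<Rightarrow> complex. (\<Sum>j<n. cmod (a (i, j))) < r})"
      by (intro open_INT ballI open_Collect_less continuous_on_const) auto
    also have "(\<Inter>i\<in>{..<n}. {a :: nat \<times> nat \<Rightarrow> complex. (\<Sum>j<n. cmod (a (i, j))) < r}) = U r"
      unfolding U_def by auto
    finally show ?thesis .
  qed
  moreover have "continuous_on (U r) (\<lambda>a. per_log n (Matrix.mat n n a))" if "r \<in> {0<..<1}" for r
    unfolding per_log_def
  proof (rule uniform_limit_theorem)
    show "uniform_limit (U r) (\<lambda>m a. \<Sum>k<m. log_per_coeff n k (Matrix.mat n n a))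
        (\<lambda>a. suminf (\<lambda>k. log_per_coeff n k (Matrix.mat n n a))) sequentially"
    proof (rule Weierstrass_m_test)
      fix k a assume "a \<in> U r"
      then show "cmod (log_per_coeff n k (Matrix.mat n n a)) \<le> real n * r ^ Suc k"
        using that by (intro norm_log_per_coeff_le) (auto simp: U_def less_imp_le)
    next
      show "summable (\<lambda>k. real n * r ^ Suc k)"
        using that by (intro summable_mult) (simp add: summable_Suc_iff summable_geometric del: power_Suc)
    qed
    show "\<forall>\<^sub>F m in sequentially.
        continuous_on (U r) (\<lambda>a. \<Sum>k<m. log_per_coeff n k (Matrix.mat n n a))"
      by (intro always_eventually allI continuous_on_sum
          continuous_on_entry_polynomial[OF entry_polynomial_log_per_coeff])
  qed simp
  ultimately show "continuous_on {a. Matrix.mat n n a \<in> row_dominated n}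
      (\<lambda>a. per_log n (Matrix.mat n n a))"
    by (simp only: continuous_on_open_UN)
next
  fix A assume A: "A \<in> row_dominated n"
  then obtain r where r: "0 < r" "r < 1" "\<And>i. i < n \<Longrightarrow> (\<Sum>j<n. cmod (A $$ (i, j))) < r"
    using row_dominated_uniform by blast
  then have "exp (per_log n A) = poly (per_poly n A) 1"
    by (intro exp_per_log[of r]) (auto simp: less_imp_le)
  then show "exp (per_log n A) = permanent (1\<^sub>m n + A)"
    using A by (simp add: poly_per_poly_1 row_dominated_def)
next
  \<comment> \<open>The bound is applied with \<open>r = 0\<close>; the positive exponent makes
    every term vanish.\<close>
  have "cmod (log_per_coeff n k (0\<^sub>m n n)) \<le> real n * 0 ^ Suc k" for k
    by (rule norm_log_per_coeff_le) auto
  then show "per_log n (0\<^sub>m n n) = 0"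
    by (simp add: per_log_def)
qed

text \<open>Along the segment from 0 to \<open>A\<close>, the difference of two branches is
  continuous with values in the multiples of 2 pi i. Distinct values are at least 2 pi apart, so it
  is constant, and it is 0 at the zero matrix.\<close>

lemma ln_per_branch_unique:
  assumes L: "is_ln_per_branch n L" and L': "is_ln_per_branch n L'" and A: "A \<in> row_dominated n"
  shows "L A = L' A"
proof -
  define a where "a t v = complex_of_real t * A $$ v" for t v
  have carrier: "A \<in> carrier_mat n n"
    using A by (simp add: row_dominated_def)
  have dom: "Matrix.mat n n (a t) \<in> row_dominated n" if "t \<in> {0..1}" for t
  proof -
    have "(\<Sum>j<n. cmod (Matrix.mat n n (a t) $$ (i, j))) < 1" if "i < n" for i
    proof -
      have "(\<Sum>j<n. cmod (Matrix.mat n n (a t) $$ (i, j))) \<le> (\<Sum>j<n. cmod (A $$ (i, j)))"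
        using \<open>t \<in> {0..1}\<close> that by (intro sum_mono) (simp add: a_def norm_mult mult_left_le_one_le)
      also have "\<dots> < 1" using A that by (simp add: row_dominated_def)
      finally show ?thesis .
    qed
    then show ?thesis by (simp add: row_dominated_def)
  qed
  define h where "h t = L (Matrix.mat n n (a t)) - L' (Matrix.mat n n (a t))" for t
  have cont_a: "continuous_on {0..1} a"
    by (rule continuous_on_coordinatewise_then_product) (auto simp: a_def intro!: continuous_intros)
  have cont: "continuous_on {0..1} (\<lambda>t. K (Matrix.mat n n (a t)))" if "is_ln_per_branch n K" for K
  proof (rule continuous_on_compose2[OF _ cont_a])
    show "continuous_on {a. Matrix.mat n n a \<in> row_dominated n} (\<lambda>a. K (Matrix.mat n n a))"
      using that unfolding is_ln_per_branch_def by (rule conjunct1)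
    show "a ` {0..1} \<subseteq> {a. Matrix.mat n n a \<in> row_dominated n}"
      using dom by blast
  qed
  have "continuous_on {0..1} h"
    unfolding h_def by (intro continuous_on_diff cont L L')
  moreover have "2 * pi \<le> cmod (h s - h t)" if "s \<in> {0..1}" "t \<in> {0..1}" "h s \<noteq> h t" for s t
  proof -
    have "exp (h u) = 1" if "u \<in> {0..1}" for u
    proof -
      have "exp (L (Matrix.mat n n (a u))) = exp (L' (Matrix.mat n n (a u)))"
        using L L' dom[OF that] unfolding is_ln_per_branch_def by simp
      then show ?thesis by (simp add: h_def exp_diff)
    qed
    then have "exp (h s) = exp (h t)" using that by simp
    then obtain k :: int where k: "h s = h t + of_int (2 * k) * pi * \<i>"
      unfolding exp_eq by auto
    with that have "k \<noteq> 0" by auto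
    then have "1 \<le> \<bar>real_of_int k\<bar>" by linarith
    then show ?thesis
      using k by (simp add: norm_mult)
  qed
  ultimately have "h constant_on {0..1}"
    by (intro continuous_discrete_range_constant) (auto intro!: exI[of _ "2 * pi"])
  then have "h 1 = h 0"
    unfolding constant_on_def by force
  moreover have "Matrix.mat n n (a 1) = A" "Matrix.mat n n (a 0) = 0\<^sub>m n n"
    using carrier by (auto simp: a_def)
  ultimately show ?thesis
    using L L' unfolding h_def is_ln_per_branch_def by simp
qed

text \<open>Existence makes the chosen function a branch, and uniqueness identifies it with the
  series on the domain.\<close>

lemma ln_per_eq_per_log:
  assumes "A \<in> row_dominated n"
  shows "ln_per n A = per_log n A"
proof -
  have "is_ln_per_branch n (ln_per n)"
    unfolding ln_per_def by (rule someI[where P = "is_ln_per_branch n", OF is_ln_per_branch_per_log])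
  then show ?thesis
    using is_ln_per_branch_per_log assms by (rule ln_per_branch_unique)
qed

section \<open>Truncation error and choice of the order\<close>

lemma ln_per_truncation_error:
  assumes "0 < r" "r < 1" and A: "A \<in> carrier_mat n n" "\<And>i. i < n \<Longrightarrow> (\<Sum>j<n. cmod (A $$ (i, j))) < r"
  shows "cmod (ln_per n A - (\<Sum>k<m. log_per_coeff n k A)) \<le> real n * r ^ m / (1 - r)"
proof -
  have "A \<in> row_dominated n"
    using A \<open>r < 1\<close> unfolding row_dominated_def by (auto intro: less_trans)
  have bound: "cmod (log_per_coeff n k A) \<le> real n * r ^ k" for k
  proof -
    have "cmod (log_per_coeff n k A) \<le> real n * r ^ Suc k"
      using assms by (intro norm_log_per_coeff_le) (auto simp: less_imp_le)
    also have "\<dots> \<le> real n * r ^ k"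
      using assms by (intro mult_left_mono power_decreasing) auto
    finally show ?thesis .
  qed
  have geom: "(\<lambda>k. real n * r ^ (k + m)) sums (real n * r ^ m / (1 - r))"
    using sums_mult[OF geometric_sums[of r], of "real n * r ^ m"] assms
    by (simp add: power_add mult_ac)
  have "summable (\<lambda>k. real n * r ^ k)"
    using assms by (intro summable_mult summable_geometric) auto
  then have "summable (\<lambda>k. log_per_coeff n k A)"
    using bound by (rule summable_comparison_test'[where N = 0])
  then have "ln_per n A - (\<Sum>k<m. log_per_coeff n k A) = suminf (\<lambda>k. log_per_coeff n (k + m) A)"
    using suminf_split_initial_segment[of "\<lambda>k. log_per_coeff n k A" m]
    by (simp add: ln_per_eq_per_log[OF \<open>A \<in> row_dominated n\<close>] per_log_def)
  also have "cmod \<dots> \<le> suminf (\<lambda>k. real n * r ^ (k + m))"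
    using bound by (intro norm_suminf_le sums_summable[OF geom]) auto
  also have "\<dots> = real n * r ^ m / (1 - r)"
    using geom by (rule sums_unique[symmetric])
  finally show ?thesis .
qed

lemma truncation_order_exists:
  fixes lam :: real
  assumes "0 < lam" "lam < 1"
  obtains C where "C > 0"
    "\<And>n \<epsilon>. n \<ge> (1::nat) \<Longrightarrow> 0 < \<epsilon> \<Longrightarrow> \<epsilon> < 1 \<Longrightarrow>
      \<exists>m. real m \<le> C * (ln (real (max n 2)) - ln \<epsilon>) \<and> real n * lam ^ m / (1 - lam) \<le> \<epsilon>"
proof -
  define \<mu> where "\<mu> = - ln lam"
  define K where "K = - ln (1 - lam)"
  \<comment> \<open>Chosen so that \<open>(X + K) / \<mu> + 1 \<le> C * X\<close> for the
    \<open>X\<close> below: since \<open>X \<ge> ln 2\<close>, both the constant \<open>K\<close>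
    and the rounding error 1 are at most multiples of \<open>X\<close>. The bound on
    \<open>X\<close> comes from \<open>max n 2\<close>.\<close>
  define C where "C = (1 + K / ln 2) / \<mu> + 1 / ln 2"
  have "\<mu> > 0" "K > 0" using assms by (auto simp: \<mu>_def K_def)
  then have "C > 0" by (auto simp: C_def intro!: add_pos_pos divide_pos_pos)
  have "\<exists>m. real m \<le> C * (ln (real (max n 2)) - ln \<epsilon>) \<and> real n * lam ^ m / (1 - lam) \<le> \<epsilon>"
    if "n \<ge> 1" "0 < \<epsilon>" "\<epsilon> < 1" for n \<epsilon>
  proof -
    define X where "X = ln (real (max n 2)) - ln \<epsilon>"
    have "ln 2 \<le> ln (real (max n 2))" by simp
    moreover have "ln \<epsilon> < 0" using that by simp
    ultimately have "ln 2 \<le> X" unfolding X_def by linarith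
    \<comment> \<open>After taking logarithms, the error bound asks for
      \<open>real m * \<mu>\<close> to be at least \<open>ln n - ln \<epsilon> + K\<close>, which is
      at most \<open>X + K\<close>.\<close>
    define m where "m = nat \<lceil>(X + K) / \<mu>\<rceil>"
    have "(X + K) / \<mu> \<ge> 0"
      using \<open>ln 2 \<le> X\<close> \<open>K > 0\<close> \<open>\<mu> > 0\<close> ln_ge_zero[of "2::real"] by (intro divide_nonneg_pos) linarith+
    then have m: "(X + K) / \<mu> \<le> real m" "real m \<le> (X + K) / \<mu> + 1"
      unfolding m_def by linarith+
    have "1 \<le> X / ln 2" using \<open>ln 2 \<le> X\<close> by simp
    then have "K \<le> K / ln 2 * X"
      using mult_left_mono[of 1 "X / ln 2" K] \<open>K > 0\<close> by simp
    then have "(X + K) / \<mu> \<le> (X + K / ln 2 * X) / \<mu>"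
      using \<open>\<mu> > 0\<close> by (intro divide_right_mono) auto
    with m(2) \<open>1 \<le> X / ln 2\<close> have "real m \<le> (X + K / ln 2 * X) / \<mu> + X / ln 2" by linarith
    also have "\<dots> = C * X" unfolding C_def using \<open>\<mu> > 0\<close> by (simp add: field_simps)
    finally have "real m \<le> C * X" .
    have "ln (real n) \<le> ln (real (max n 2))" using that(1) by simp
    moreover have "X + K \<le> real m * \<mu>"
      using m(1) \<open>\<mu> > 0\<close> by (simp add: field_simps)
    ultimately have "ln (real n) + real m * ln lam - ln (1 - lam) \<le> ln \<epsilon>"
      unfolding X_def K_def \<mu>_def by simp
    moreover have "ln (real n * lam ^ m / (1 - lam)) = ln (real n) + real m * ln lam - ln (1 - lam)"
      using that assms by (simp add: ln_div ln_mult ln_realpow)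
    ultimately have "real n * lam ^ m / (1 - lam) \<le> \<epsilon>"
      using that assms by (subst ln_le_cancel_iff[symmetric]) (auto intro!: divide_pos_pos mult_pos_pos)
    with \<open>real m \<le> C * X\<close> show ?thesis unfolding X_def by blast
  qed
  with \<open>C > 0\<close> that show ?thesis by blast
qed

theorem theorem1p3:
  fixes lam :: real
  assumes "0 < lam" and "lam < 1"
  shows "\<exists>C::real. C > 0 \<and>
    (\<forall>n::nat. n \<ge> 1 \<longrightarrow> (\<forall>\<epsilon>::real. 0 < \<epsilon> \<and> \<epsilon> < 1 \<longrightarrow>
      (\<exists>p::entry_poly.
        poly_vars p \<subseteq> {0..<n} \<times> {0..<n} \<and>
        real (total_degree p) \<le> C * (ln (real (max n 2)) - ln \<epsilon>) \<and>
        (\<forall>A \<in> carrier_mat n n.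
          (\<forall>i<n. (\<Sum>j<n. cmod (A $$ (i, j))) < lam) \<longrightarrow>
          cmod (ln_per n A - eval_poly p A) \<le> \<epsilon>))))"
proof -
  obtain C where "C > 0" and C: "\<And>n \<epsilon>. n \<ge> (1::nat) \<Longrightarrow> 0 < \<epsilon> \<Longrightarrow> \<epsilon> < 1 \<Longrightarrow>
      \<exists>m. real m \<le> C * (ln (real (max n 2)) - ln \<epsilon>) \<and> real n * lam ^ m / (1 - lam) \<le> \<epsilon>"
    using truncation_order_exists[OF assms] by blast
  show ?thesis
  proof (intro exI[of _ C] conjI allI impI \<open>C > 0\<close>)
    fix n :: nat and \<epsilon> :: real
    assume "n \<ge> 1" "0 < \<epsilon> \<and> \<epsilon> < 1"
    then obtain m where m: "real m \<le> C * (ln (real (max n 2)) - ln \<epsilon>)"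
      "real n * lam ^ m / (1 - lam) \<le> \<epsilon>"
      using C by blast
    \<comment> \<open>The term with index \<open>k\<close> has degree at most \<open>k + 1\<close>,
      so the first \<open>m\<close> terms stay within degree \<open>m\<close>.\<close>
    have "entry_polynomial n m (log_per_coeff n k)" if "k < m" for k
      using entry_polynomial_log_per_coeff[of n k] that
      unfolding entry_polynomial_def by (meson Suc_leI le_trans)
    then have "entry_polynomial n m (\<lambda>A. \<Sum>k<m. log_per_coeff n k A)"
      by (intro entry_polynomial_sum) simp
    then obtain p where p: "poly_vars p \<subseteq> {0..<n} \<times> {0..<n}" "total_degree p \<le> m"
      "\<And>A. (\<Sum>k<m. log_per_coeff n k A) = eval_poly p A"
      unfolding entry_polynomial_def by blast
    have "cmod (ln_per n A - eval_poly p A) \<le> \<epsilon>"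
      if "A \<in> carrier_mat n n" "\<forall>i<n. (\<Sum>j<n. cmod (A $$ (i, j))) < lam" for A
      using ln_per_truncation_error[OF assms that(1), of m] that(2) m(2) unfolding p(3) by fastforce
    moreover have "real (total_degree p) \<le> C * (ln (real (max n 2)) - ln \<epsilon>)"
      using m(1) p(2) by (meson of_nat_mono order_trans)
    ultimately show "\<exists>p. poly_vars p \<subseteq> {0..<n} \<times> {0..<n} \<and>
        real (total_degree p) \<le> C * (ln (real (max n 2)) - ln \<epsilon>) \<and>
        (\<forall>A \<in> carrier_mat n n. (\<forall>i<n. (\<Sum>j<n. cmod (A $$ (i, j))) < lam) \<longrightarrow>
          cmod (ln_per n A - eval_poly p A) \<le> \<epsilon>)"
      using p(1) by blast
  qed
qed

end
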